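(* Let $n\geq3$ and let $\mathcal{E}\subset\mathbb{C}^{n\times n}$ be the set of complex matrices all of whose eigenvalues lie in the closed left half-plane $\{z\in\mathbb{C}:\Re z\le0\}$. If $A\in\mathbb{R}^{n\times n}$ is sampled uniformly from the unit sphere $\{A\in\mathbb{R}^{n\times n}:\|A\|_F=1\}$, then $$0<\mathbb{P}\bigl(d_{\mathbb{R}}(A)=d_{\mathbb{C}}(A)\bigr)<1.$$
   Context: $\|\cdot\|_F$ is the Frobenius norm. For $A\in\mathbb{R}^{n\times n}$, $d_{\mathbb{C}}(A)=\min_{X\in\mathcal{E}}\|A-X\|_F$ and $d_{\mathbb{R}}(A)=\min_{X\in\mathcal{E}\cap\mathbb{R}^{n\times n}}\|A-X\|_F$. The event $d_{\mathbb{R}}(A)=d_{\mathbb{C}}(A)$ is the event that $A$ has a real nearest matrix in $\mathcal{E}$. *)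

theory Defs
  imports "HOL-Probability.Probability"
begin

definition eigenvalue :: "'a::field ^ 'n ^ 'n \<Rightarrow> 'a \<Rightarrow> bool" where
  "eigenvalue X z \<longleftrightarrow> (\<exists>v. v \<noteq> 0 \<and> X *v v = z *s v)"

definition left_half_plane_matrices :: "(complex ^ 'n ^ 'n) set" where
  "left_half_plane_matrices = {X. \<forall>z. eigenvalue X z \<longrightarrow> Re z \<le> 0}"

definition complex_matrix :: "real ^ 'n ^ 'm \<Rightarrow> complex ^ 'n ^ 'm" where
  "complex_matrix A = (\<chi> i j. complex_of_real (A $ i $ j))"

text \<open>The library norm of a vector of vectors is the Frobenius norm of the matrix.\<close>

lemma norm_matrix_eq_frobenius:
  fixes X :: "'a::real_normed_vector ^ 'n ^ 'm"
  shows "norm X = sqrt (\<Sum>i\<in>UNIV. \<Sum>j\<in>UNIV. (norm (X $ i $ j))\<^sup>2)"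
  by (simp add: norm_vec_def L2_set_def sum_nonneg)

text \<open>The two minima are written as infima; the sets are nonempty (they contain the zero
  matrix), and the minima are attained because the sets are closed.\<close>

definition dist_complex :: "real ^ 'n ^ 'n \<Rightarrow> real" where
  "dist_complex A = (INF X \<in> left_half_plane_matrices. norm (complex_matrix A - X))"

definition dist_real :: "real ^ 'n ^ 'n \<Rightarrow> real" where
  "dist_real A =
    (INF X \<in> left_half_plane_matrices \<inter> range complex_matrix. norm (complex_matrix A - X))"

text \<open>The uniform distribution on the unit sphere, as the law of the radial projection of a
  uniformly distributed point of the unit ball. The projection sends the origin, a null set, to
  the origin; restricting to the sphere afterwards removes this artefact.\<close>

definition uniform_unit_sphere :: "'a::euclidean_space measure" where
  "uniform_unit_sphere =
    restrict_space (distr (uniform_measure lborel (ball 0 1)) borel sgn) (sphere 0 1)"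

lemma space_uniform_unit_sphere: "space uniform_unit_sphere = sphere 0 1"
  by (simp add: uniform_unit_sphere_def space_restrict_space)

lemma prob_space_uniform_unit_sphere:
  "prob_space (uniform_unit_sphere :: 'a::euclidean_space measure)"
proof -
  let ?U = "uniform_measure lborel (ball (0::'a) 1)"
  have pos: "emeasure lborel (ball (0::'a) 1) \<noteq> 0"
    using content_ball_pos[of 1 "0::'a"] by (auto simp: measure_def)
  have fin: "emeasure lborel (ball (0::'a) 1) \<noteq> \<infinity>"
    using emeasure_lborel_ball_finite[of "0::'a" 1] by simp
  have U: "prob_space ?U"
    by (rule prob_space_uniform_measure[OF pos fin])
  have m: "sgn \<in> ?U \<rightarrow>\<^sub>M (borel :: 'a measure)"
    unfolding sgn_div_norm by measurable
  interpret D: prob_space "distr ?U borel sgn"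
    by (rule prob_space.prob_space_distr[OF U m])
  have null: "{0::'a} \<in> null_sets ?U"
  proof (intro null_setsI)
    have "emeasure lborel (ball 0 1 \<inter> {0::'a}) \<le> emeasure lborel {0::'a}"
      by (intro emeasure_mono) auto
    then show "emeasure ?U {0} = 0"
      by simp
  qed simp
  have "AE x in ?U. sgn x \<in> sphere (0::'a) 1"
    using AE_not_in[OF null] by eventually_elim (auto simp: norm_sgn)
  then have "AE y in distr ?U borel sgn. y \<in> sphere (0::'a) 1"
    by (subst AE_distr_iff[OF m]) (auto simp: closed_sphere borel_closed)
  then have "emeasure (distr ?U borel sgn) (sphere (0::'a) 1) = 1"
    by (subst (asm) D.AE_in_set_eq_1) (auto simp: D.emeasure_eq_measure closed_sphere borel_closed)
  then show ?thesis
    unfolding uniform_unit_sphere_def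
    by (intro prob_space_restrict_space) (auto simp: closed_sphere borel_closed)
qed

end

(* A real matrix Y with all eigenvalues in the closed left half-plane has det(-Y) >= 0, since
   det(tI - Y) cannot vanish for t > 0. Hence if det(-A) < 0 and |Aw| >= |w| for all w, then no
   such Y is closer to A than 1: otherwise the determinant would not vanish on the segment from -A
   to -Y, giving det(-Y) < 0.
   A complex matrix in the set is not subject to the sign condition, and for a suitable A there is
   one at distance sqrt(178/196) < 1. The strict inequality d_C < d_R is an open condition and so
   has positive probability, while near a negative multiple of the identity both distances are 0. *)

theory Submission
  imports Defs
begin

section \<open>Matrix norms and sign changes of the determinant\<close>

text \<open>Cauchy-Schwarz in each row, then summation of the squares over the rows.\<close>

lemma norm_matrix_vector_mult_le:
  fixes M :: "'a::real_normed_field ^ 'n ^ 'm" and v :: "'a ^ 'n"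
  shows "norm (M *v v) \<le> norm M * norm v"
proof -
  have row: "norm ((M *v v) $ i) \<le> norm v * norm (M $ i)" for i
  proof -
    have "norm ((M *v v) $ i) \<le> (\<Sum>j\<in>UNIV. norm (M $ i $ j * v $ j))"
      by (simp add: matrix_vector_mult_def norm_sum)
    also have "\<dots> = (\<Sum>j\<in>UNIV. \<bar>norm (M $ i $ j)\<bar> * \<bar>norm (v $ j)\<bar>)"
      by (simp add: norm_mult)
    also have "\<dots> \<le> norm (M $ i) * norm v"
      unfolding norm_vec_def by (rule L2_set_mult_ineq)
    finally show ?thesis by (simp add: mult.commute)
  qed
  have "norm (M *v v) \<le> L2_set (\<lambda>i. norm v * norm (M $ i)) UNIV"
    unfolding norm_vec_def[of "M *v v"] by (intro L2_set_mono row) simp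
  also have "\<dots> = norm v * norm M"
    by (simp add: L2_set_right_distrib norm_vec_def[of M])
  finally show ?thesis by (simp add: mult.commute)
qed

lemma continuous_on_det:
  fixes f :: "'b::topological_space \<Rightarrow> real ^ 'n ^ 'n"
  assumes "continuous_on S f"
  shows "continuous_on S (\<lambda>x. det (f x))"
  unfolding det_def by (intro continuous_intros assms)

text \<open>By the intermediate value theorem, a change of sign along the segment would force a zero
  of the determinant.\<close>

lemma det_neg_along_segment:
  fixes P Q :: "real ^ 'n ^ 'n"
  assumes nz: "\<And>t. 0 \<le> t \<Longrightarrow> t \<le> 1 \<Longrightarrow> det ((1 - t) *\<^sub>R P + t *\<^sub>R Q) \<noteq> 0"
    and "det P < 0"
  shows "det Q < 0"
proof (rule ccontr)
  assume "\<not> det Q < 0"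
  let ?f = "\<lambda>t. det ((1 - t) *\<^sub>R P + t *\<^sub>R Q)"
  have "\<exists>t\<ge>0. t \<le> 1 \<and> ?f t = 0"
    using assms(2) \<open>\<not> det Q < 0\<close>
    by (intro IVT') (auto intro!: continuous_on_det continuous_intros)
  then show False using nz by blast
qed

lemma singular_matrix_kernel:
  fixes A :: "'a::field ^ 'n ^ 'n"
  assumes "det A = 0"
  obtains v where "v \<noteq> 0" "A *v v = 0"
  using assms invertible_det_nz[of A] matrix_left_invertible_ker[of A] invertible_left_inverse[of A]
  by auto

lemma norm_complex_matrix [simp]: "norm (complex_matrix A) = norm A"
  by (simp add: norm_matrix_eq_frobenius complex_matrix_def)

lemma linear_complex_matrix: "linear complex_matrix"
  by (intro linearI)
    (simp_all add: complex_matrix_def vec_eq_iff scaleR_conv_of_real[where 'a = complex])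

section \<open>The determinant condition on real stable matrices\<close>

text \<open>If det(-Y) < 0, the segment from -Y to I, whose end has determinant 1, passes through a
  singular matrix (1 - s)(-Y) + s I with 0 < s < 1. Dividing by 1 - s turns a kernel vector into an
  eigenvector of Y for the positive eigenvalue s / (1 - s).\<close>

lemma det_uminus_nonneg_if_stable:
  fixes Y :: "real ^ 'n ^ 'n"
  assumes stable: "complex_matrix Y \<in> left_half_plane_matrices"
  shows "det (- Y) \<ge> 0"
proof (rule ccontr)
  assume neg: "\<not> det (- Y) \<ge> 0"
  obtain s where s: "0 \<le> s" "s \<le> 1" "det ((1 - s) *\<^sub>R (- Y) + s *\<^sub>R mat 1) = 0"
    using det_neg_along_segment[of "- Y" "mat 1"] neg by fastforce
  moreover have "s \<noteq> 0" "s \<noteq> 1"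
    using s(3) neg by auto
  ultimately have s01: "0 < s" "s < 1" by auto
  obtain v where v: "v \<noteq> 0" "((1 - s) *\<^sub>R (- Y) + s *\<^sub>R mat 1) *v v = 0"
    using singular_matrix_kernel[OF s(3)] .
  then have Yv: "(1 - s) *\<^sub>R (Y *v v) = s *\<^sub>R v"
    by (simp add: matrix_vector_mult_diff_rdistrib flip: scaleR_matrix_vector_assoc)
  define t where "t = s / (1 - s)"
  have Yt: "Y *v v = t *\<^sub>R v"
  proof -
    have "Y *v v = (1 / (1 - s)) *\<^sub>R ((1 - s) *\<^sub>R (Y *v v))"
      using s01 by simp
    then show ?thesis unfolding Yv t_def by simp
  qed
  let ?w = "(\<chi> i. complex_of_real (v $ i))"
  have "eigenvalue (complex_matrix Y) (of_real t)"
    unfolding eigenvalue_def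
  proof (intro exI conjI)
    show "?w \<noteq> 0" using v(1) by (auto simp: vec_eq_iff)
    show "complex_matrix Y *v ?w = complex_of_real t *s ?w"
      using Yt by (auto simp: vec_eq_iff complex_matrix_def matrix_vector_mult_def
          simp flip: of_real_mult of_real_sum)
  qed
  moreover have "t > 0" using s01 by (simp add: t_def)
  ultimately show False
    using stable by (auto simp: left_half_plane_matrices_def)
qed

section \<open>Continuity of the two distances\<close>

lemma zero_stable_real: "0 \<in> left_half_plane_matrices \<inter> range complex_matrix"
  using linear_0[OF linear_complex_matrix]
  by (auto simp: left_half_plane_matrices_def eigenvalue_def intro!: image_eqI[of _ _ 0])

text \<open>\<open>infdist\<close> is continuous in the point. It agrees with the infimum only for
  nonempty sets, being 0 by convention on the empty set; hence the appeal to the zero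
  matrix.\<close>

lemma dist_complex_eq_infdist:
  "dist_complex A = infdist (complex_matrix A) left_half_plane_matrices"
  using zero_stable_real by (subst infdist_notempty) (auto simp: dist_complex_def dist_norm)

lemma dist_real_eq_infdist:
  "dist_real A = infdist (complex_matrix A) (left_half_plane_matrices \<inter> range complex_matrix)"
  using zero_stable_real by (subst infdist_notempty) (auto simp: dist_real_def dist_norm)

lemma continuous_dist_complex: "continuous_on UNIV dist_complex"
  unfolding dist_complex_eq_infdist
  by (intro continuous_on_infdist linear_continuous_on linear_conv_bounded_linear[THEN iffD1]
      linear_complex_matrix)

lemma continuous_dist_real: "continuous_on UNIV dist_real"
  unfolding dist_real_eq_infdist
  by (intro continuous_on_infdist linear_continuous_on linear_conv_bounded_linear[THEN iffD1]
      linear_complex_matrix)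

section \<open>Open sets under the uniform distribution on the sphere\<close>

lemma emeasure_lborel_open_nonzero:
  fixes S :: "'a::euclidean_space set"
  assumes "open S" "S \<noteq> {}"
  shows "emeasure lborel S \<noteq> 0"
proof
  assume "emeasure lborel S = 0"
  then have "S \<in> null_sets (completion lborel)"
    using assms(1) by (intro null_sets_completionI null_setsI) auto
  then show False
    using open_not_negligible[OF assms] by (simp add: negligible_iff_null_sets)
qed

text \<open>The points of the unit ball that project radially into \<open>W\<close> form an open set
  containing x/2, and a nonempty open set has positive Lebesgue measure.\<close>

lemma measure_uniform_unit_sphere_pos:
  fixes W :: "'a::euclidean_space set"
  assumes "open W" and x: "x \<in> W" "norm x = 1"
  shows "measure uniform_unit_sphere (W \<inter> sphere 0 1) > 0"
proof -
  let ?B = "ball (0::'a) 1"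
  let ?U = "uniform_measure lborel ?B"
  let ?V = "sgn -` (W \<inter> sphere 0 1) :: 'a set"
  have pos: "emeasure lborel ?B \<noteq> 0"
    using content_ball_pos[of 1 "0::'a"] by (auto simp: measure_def)
  have fin: "emeasure lborel ?B \<noteq> \<infinity>"
    using emeasure_lborel_ball_finite[of "0::'a" 1] by simp
  have m: "sgn \<in> ?U \<rightarrow>\<^sub>M (borel :: 'a measure)"
    unfolding sgn_div_norm by measurable
  have mW: "W \<inter> sphere 0 1 \<in> sets borel"
    using assms(1) by (intro sets.Int borel_open borel_closed) auto
  \<comment> \<open>\<open>sgn\<close> is continuous only off the origin. Since
    \<open>sgn 0 = 0\<close> is not on the sphere, the preimage already avoids the origin and is
    therefore open.\<close>
  have V: "?V = sgn -` W \<inter> (- {0})"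
    by (auto simp: norm_sgn sgn_zero_iff)
  have "continuous_on (- {0}) (sgn :: 'a \<Rightarrow> 'a)"
    by (intro continuous_on_sgn continuous_on_id) auto
  then have "open ?V"
    unfolding V using assms(1) by (subst Int_commute) (intro continuous_open_preimage, auto)
  then have o: "open (?B \<inter> ?V)" by auto
  have "sgn ((1/2) *\<^sub>R x) = x"
    using x by (simp add: sgn_div_norm)
  then have "(1/2) *\<^sub>R x \<in> ?B \<inter> ?V"
    using x by simp
  then have "emeasure lborel (?B \<inter> ?V) \<noteq> 0"
    using emeasure_lborel_open_nonzero[OF o] by blast
  moreover have "emeasure lborel (?B \<inter> ?V) \<noteq> \<infinity>"
    using fin emeasure_mono[of "?B \<inter> ?V" ?B lborel] by (auto simp: top_unique)
  ultimately have "measure lborel (?B \<inter> ?V) > 0"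
    by (simp add: measure_def enn2real_positive_iff less_top zero_less_iff_neq_zero)
  moreover have "measure uniform_unit_sphere (W \<inter> sphere 0 1) = measure ?U ?V"
    unfolding uniform_unit_sphere_def using m mW
    by (simp add: measure_restrict_space measure_distr)
  moreover have "?V \<in> sets lborel" using \<open>open ?V\<close> by simp
  moreover have "measure lborel ?B > 0" using content_ball_pos[of 1 "0::'a"] by simp
  ultimately show ?thesis
    using pos fin by simp
qed

section \<open>Identities for matrix-vector products and scalar multiples\<close>

lemma uminus_matrix_vector_mult: "(- A) *v v = - (A *v v)"
  for A :: "'a::ring_1 ^ 'n ^ 'm"
  by (simp add: vec_eq_iff matrix_vector_mult_def sum_negf)

lemma scaleR_matrix_vector_mult: "(r *\<^sub>R A) *v v = r *\<^sub>R (A *v v)"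
  for A :: "'a::real_algebra_1 ^ 'n ^ 'm"
  by (simp add: vec_eq_iff matrix_vector_mult_def scaleR_sum_right)

lemma norm_vector_smult: "norm (k *s v) = norm k * norm v"
  for v :: "'a::real_normed_field ^ 'n"
  by (simp add: norm_vec_def norm_mult L2_set_right_distrib)

section \<open>A real matrix at distance at least 1 from all real stable matrices\<close>

text \<open>For distinct arguments this is the 3-cycle a -> b -> c -> a. As a product of two
  transpositions it is visibly even.\<close>

definition cyc :: "'n \<Rightarrow> 'n \<Rightarrow> 'n \<Rightarrow> 'n \<Rightarrow> 'n" where
  "cyc a b c = Transposition.transpose a b \<circ> Transposition.transpose b c"

lemma permutes_cyc: "cyc a b c permutes UNIV"
  unfolding cyc_def by (intro permutes_compose permutes_swap_id) auto

lemma sign_cyc: "a \<noteq> b \<Longrightarrow> b \<noteq> c \<Longrightarrow> sign (cyc a b c) = 1"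
  for a :: "'n::finite"
  by (simp add: cyc_def sign_compose permutation_swap_id sign_swap_id)

definition direction :: "'n \<Rightarrow> 'n \<Rightarrow> 'n \<Rightarrow> real ^ 'n" where
  "direction a b c = (\<chi> i. if i = a then 1 else if i = b then -1 else if i = c then 2 else 0)"

text \<open>This is \<open>S (I + t p p\<^sup>T) \<oplus> (-I)\<close>, where \<open>S\<close> is the
  permutation matrix of the cycle and \<open>p = (1, -1, 2)\<close>. For \<open>t = 1\<close> the block on \<open>{a, b, c}\<close> is
  \<open>[[-1, 2, -2], [2, -2, 5], [2, -1, 2]]\<close>.\<close>

definition cycle_matrix :: "'n \<Rightarrow> 'n \<Rightarrow> 'n \<Rightarrow> real \<Rightarrow> real ^ 'n ^ 'n" where
  "cycle_matrix a b c t = (\<chi> i j. (if i \<in> {a, b, c} then 1 else - 1) *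
     ((if cyc a b c i = j then 1 else 0) + t * direction a b c $ cyc a b c i * direction a b c $ j))"

text \<open>Up to signs and a permutation of the coordinates, the image of \<open>w\<close> is u =
  (I + t p p^T) w. Expanding |u|^2 adds to |w|^2 only multiples of (p . w)^2 with nonnegative
  coefficients.\<close>

lemma norm_le_norm_cycle_matrix_mult:
  fixes w :: "real ^ 'n"
  assumes "t \<ge> 0"
  shows "norm w \<le> norm (cycle_matrix a b c t *v w)"
proof (rule power2_le_imp_le)
  let ?p = "direction a b c" and ?\<sigma> = "cyc a b c"
  let ?u = "w + (t * (?p \<bullet> w)) *\<^sub>R ?p"
  have row: "(cycle_matrix a b c t *v w) $ i = (if i \<in> {a, b, c} then 1 else - 1) * ?u $ ?\<sigma> i" for i
  proof -
    have "(\<Sum>j\<in>UNIV. (if ?\<sigma> i = j then 1 else 0) * w $ j) = w $ ?\<sigma> i"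
      by (simp add: if_distribR[of _ _ _ "_ :: real"] if_distrib[of "\<lambda>x. x * _"] cong: if_cong)
    then have "(\<Sum>j\<in>UNIV. ((if ?\<sigma> i = j then 1 else 0) + t * ?p $ ?\<sigma> i * ?p $ j) * w $ j) = ?u $ ?\<sigma> i"
      by (simp add: distrib_right sum.distrib)
        (simp add: inner_vec_def sum_distrib_left sum_distrib_right mult_ac)
    then show ?thesis
      by (simp add: cycle_matrix_def matrix_vector_mult_def mult.assoc flip: sum_distrib_left)
  qed
  have "(norm (cycle_matrix a b c t *v w))\<^sup>2 = (\<Sum>i\<in>UNIV. (?u $ ?\<sigma> i)\<^sup>2)"
    unfolding power2_norm_eq_inner inner_vec_def row
    by (intro sum.cong) (auto simp: power2_eq_square)
  also have "\<dots> = (\<Sum>i\<in>UNIV. (?u $ i)\<^sup>2)"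
    using sum.permute[OF permutes_cyc, of "\<lambda>i. (?u $ i)\<^sup>2" a b c] by (simp add: o_def)
  also have "\<dots> = (norm ?u)\<^sup>2"
    unfolding power2_norm_eq_inner[of ?u] inner_vec_def[of ?u ?u] by (simp add: power2_eq_square)
  also have "\<dots> = (norm w)\<^sup>2 + 2 * t * (?p \<bullet> w)\<^sup>2 + (t * (?p \<bullet> w))\<^sup>2 * (norm ?p)\<^sup>2"
    unfolding power2_norm_eq_inner
    by (simp add: inner_add_left inner_add_right inner_commute algebra_simps power2_eq_square)
  finally show "(norm w)\<^sup>2 \<le> (norm (cycle_matrix a b c t *v w))\<^sup>2"
    using assms by simp
qed simp

text \<open>An even row permutation of a diagonal matrix with exactly three entries -1. The block -I
  becomes I after negation, so the sign is the same in every dimension.\<close>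

lemma det_uminus_cycle_matrix_0:
  fixes a b c :: "'n::finite"
  assumes "distinct [a, b, c]"
  shows "det (- cycle_matrix a b c 0) = -1"
proof -
  let ?\<sigma> = "cyc a b c"
  define D :: "real ^ 'n ^ 'n"
    where "D = (\<chi> i j. if i = j then (if i \<in> {a, b, c} then - 1 else 1) else 0)"
  \<comment> \<open>The cycle preserves the triple, so the sign of row i is also the diagonal entry
    of \<open>D\<close> at the permuted index.\<close>
  have "?\<sigma> i \<in> {a, b, c} \<longleftrightarrow> i \<in> {a, b, c}" for i
    using assms by (auto simp: cyc_def Transposition.transpose_def)
  then have "- cycle_matrix a b c 0 = (\<chi> i. D $ ?\<sigma> i)"
    by (auto simp: vec_eq_iff cycle_matrix_def D_def)
  then have "det (- cycle_matrix a b c 0) = det D"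
    using assms by (simp add: det_permute_rows[OF permutes_cyc] sign_cyc)
  also have "\<dots> = (\<Prod>i\<in>UNIV. if i \<in> {a, b, c} then - 1 else 1)"
    by (subst det_diagonal) (auto simp: D_def)
  also have "\<dots> = (\<Prod>i\<in>{a, b, c}. - 1)"
    by (subst prod.inter_restrict[symmetric]) auto
  also have "\<dots> = -1"
    using assms by simp
  finally show ?thesis .
qed

lemma det_nonzero_if_expanding:
  fixes A :: "real ^ 'n ^ 'n"
  assumes "\<And>w. norm w \<le> norm (A *v w)"
  shows "det A \<noteq> 0"
proof
  assume "det A = 0"
  then obtain v where "v \<noteq> 0" "A *v v = 0" by (rule singular_matrix_kernel)
  then show False using assms[of v] by simp
qed

text \<open>Deformation of the parameter from 0 to 1: the matrix is affine in it and, by the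
  expansion bound, never singular on the way.\<close>

lemma det_uminus_cycle_matrix_neg:
  fixes a b c :: "'n::finite"
  assumes "distinct [a, b, c]"
  shows "det (- cycle_matrix a b c 1) < 0"
proof (rule det_neg_along_segment[of "- cycle_matrix a b c 0"])
  fix t :: real assume t: "0 \<le> t" "t \<le> 1"
  have eq: "(1 - t) *\<^sub>R (- cycle_matrix a b c 0) + t *\<^sub>R (- cycle_matrix a b c 1) = - cycle_matrix a b c t"
    by (simp add: vec_eq_iff cycle_matrix_def algebra_simps)
  show "det ((1 - t) *\<^sub>R (- cycle_matrix a b c 0) + t *\<^sub>R (- cycle_matrix a b c 1)) \<noteq> 0"
    unfolding eq using norm_le_norm_cycle_matrix_mult[OF t(1)]
    by (intro det_nonzero_if_expanding) (simp add: uminus_matrix_vector_mult)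
qed (simp add: det_uminus_cycle_matrix_0[OF assms])

text \<open>A singular point on the segment from -M to -Y gives v with M v = t (M - Y) v. If |M - Y|
  < 1, then |v| <= |M v| < |v|, so the segment has no such point and det(-Y) inherits the negative
  sign.\<close>

lemma dist_real_stable_cycle_matrix_ge_1:
  fixes a b c :: "'n::finite"
  assumes d: "distinct [a, b, c]" and Y: "complex_matrix Y \<in> left_half_plane_matrices"
  shows "norm (cycle_matrix a b c 1 - Y) \<ge> 1"
proof (rule ccontr)
  let ?M = "cycle_matrix a b c 1"
  assume less: "\<not> norm (?M - Y) \<ge> 1"
  have "det (- Y) < 0"
  proof (rule det_neg_along_segment[OF _ det_uminus_cycle_matrix_neg[OF d]])
    fix t :: real assume t: "0 \<le> t" "t \<le> 1"
    show "det ((1 - t) *\<^sub>R (- ?M) + t *\<^sub>R (- Y)) \<noteq> 0"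
    proof
      assume "det ((1 - t) *\<^sub>R (- ?M) + t *\<^sub>R (- Y)) = 0"
      then obtain v where v: "v \<noteq> 0" "((1 - t) *\<^sub>R (- ?M) + t *\<^sub>R (- Y)) *v v = 0"
        by (rule singular_matrix_kernel)
      have "(1 - t) *\<^sub>R (- ?M) + t *\<^sub>R (- Y) = t *\<^sub>R (?M - Y) - ?M"
        by (simp add: algebra_simps)
      with v(2) have "t *\<^sub>R ((?M - Y) *v v) - ?M *v v = 0"
        by (simp only: scaleR_matrix_vector_mult
            matrix_vector_mult_diff_rdistrib[of "t *\<^sub>R (?M - Y)" ?M])
      then have "?M *v v = t *\<^sub>R ((?M - Y) *v v)" by simp
      then have "norm v \<le> t * norm ((?M - Y) *v v)"
        using norm_le_norm_cycle_matrix_mult[of 1 v a b c] t by simp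
      also have "\<dots> \<le> 1 * (norm (?M - Y) * norm v)"
        using t by (intro mult_mono norm_matrix_vector_mult_le) auto
      also have "\<dots> < norm v"
        using less v(1) by simp
      finally show False by simp
    qed
  qed
  with det_uminus_nonneg_if_stable[OF Y] show False by simp
qed

section \<open>A complex stable matrix at distance less than 1\<close>

text \<open>The three equations say that (x, y, w) is an eigenvector of the 3 x 3 block after the
  rank-one correction, which is the same in the first and third rows.\<close>

lemma block_eigenvalue:
  fixes x y w z :: complex
  assumes e1: "- x + 2 * y - 2 * w - ((6 + \<i>) * x + (5 - 5 * \<i>) * y + (1 - \<i>) * w) / 14 = z * x"
    and e2: "2 * x - 2 * y + 5 * w = z * y"
    and e3: "2 * x - y + 2 * w - ((6 + \<i>) * x + (5 - 5 * \<i>) * y + (1 - \<i>) * w) / 14 = z * w"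
    and nz: "x \<noteq> 0 \<or> y \<noteq> 0 \<or> w \<noteq> 0"
  shows "Re z \<le> 0"
proof -
  \<comment> \<open>The first row is the difference of the third and the first equation.\<close>
  let ?N = "vector [vector [z + 3, - 3, 4 - z], vector [2, - 2 - z, 5],
    vector [14 * z + 20 + \<i>, - 23 - 5 * \<i>, 29 - \<i>]] :: complex ^ 3 ^ 3"
  let ?v = "vector [x, y, w] :: complex ^ 3"
  have "(z + 3) * x - 3 * y + (4 - z) * w = 0"
    using arg_cong2[OF e3 e1, of minus] by (simp add: algebra_simps)
  moreover have "2 * x + (- 2 - z) * y + 5 * w = 0"
    using e2 by (simp add: algebra_simps)
  moreover have "(14 * z + 20 + \<i>) * x + (- 23 - 5 * \<i>) * y + (29 - \<i>) * w = 0"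
    using e1 by (simp add: field_simps)
  ultimately have "?N *v ?v = 0"
    by (simp add: vec_eq_iff forall_3 matrix_vector_mult_def sum_3)
  moreover have "?v \<noteq> 0"
    using nz by (simp add: vec_eq_iff forall_3)
  ultimately have "det ?N = 0"
    using invertible_det_nz[of ?N] matrix_left_invertible_ker[of ?N] invertible_left_inverse[of ?N]
    by blast
  \<comment> \<open>This is -14 times the characteristic polynomial. Its roots are the double root
    i, admissible because the half-plane is closed, and -3/2 - 2i.\<close>
  moreover have "det ?N = - 7 * ((z - \<i>) * (z - \<i>) * (2 * z + 3 + 4 * \<i>))"
    by (simp add: det_3 algebra_simps)
  ultimately have "z = \<i> \<or> 2 * z + 3 + 4 * \<i> = 0" by simp
  then show ?thesis
    by (auto simp: complex_eq_iff)
qed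

text \<open>Found by numerical pole placement: subtracting this rank-one matrix from the block above
  gives the characteristic polynomial \<open>(z - \<i>)\<^sup>2 (z + 3/2 + 2\<i>)\<close>.\<close>

definition rank_one_defect :: "'n \<Rightarrow> 'n \<Rightarrow> 'n \<Rightarrow> complex ^ 'n ^ 'n" where
  "rank_one_defect a b c = (\<chi> i j. if i \<in> {a, c} then
     (if j = a then (6 + \<i>) / 14 else if j = b then (5 - 5 * \<i>) / 14
      else if j = c then (1 - \<i>) / 14 else 0) else 0)"

lemma norm_rank_one_defect:
  fixes a b c :: "'n::finite"
  assumes "distinct [a, b, c]"
  shows "norm (rank_one_defect a b c) < 1"
proof -
  \<comment> \<open>Squared moduli in either of the two equal nonzero rows: |6 + i|^2 = 37, |5 -
    5i|^2 = 50, |1 - i|^2 = 2, each over 14^2 = 196.\<close>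
  let ?r = "\<lambda>j. if j = a then 37 / 196 else if j = b then 50 / 196 else if j = c then 2 / 196 else 0 :: real"
  have entry: "(norm (rank_one_defect a b c $ i $ j))\<^sup>2 = (if i \<in> {a, c} then ?r j else 0)" for i j
    by (simp add: rank_one_defect_def norm_divide power_divide cmod_power2)
  have row: "(\<Sum>j\<in>UNIV. ?r j) = 89 / 196"
    using assms by (subst sum.mono_neutral_right[of UNIV "{a, b, c}"]) auto
  have "(\<Sum>i\<in>UNIV. \<Sum>j\<in>UNIV. (norm (rank_one_defect a b c $ i $ j))\<^sup>2)
      = (\<Sum>i\<in>UNIV. if i \<in> {a, c} then 89 / 196 else 0)"
    unfolding entry by (intro sum.cong refl) (simp add: row)
  also have "\<dots> = 178 / 196"
    using assms by (subst sum.mono_neutral_right[of UNIV "{a, c}"]) auto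
  finally show ?thesis
    unfolding norm_matrix_eq_frobenius by (simp add: real_sqrt_lt_1_iff)
qed

text \<open>The matrix is block diagonal. An eigenvector that is nonzero somewhere on the triple
  restricts to an eigenvector of the 3 x 3 block; any other one belongs to the block -I and has
  eigenvalue -1.\<close>

lemma cycle_matrix_minus_defect_stable:
  fixes a b c :: "'n::finite"
  assumes d: "distinct [a, b, c]"
  shows "complex_matrix (cycle_matrix a b c 1) - rank_one_defect a b c \<in> left_half_plane_matrices"
    (is "?X \<in> _")
proof -
  have "Re z \<le> 0" if "v \<noteq> 0" and ev: "?X *v v = z *s v" for v z
  proof -
    have cyc: "cyc a b c a = b" "cyc a b c b = c" "cyc a b c c = a"
      "\<And>i. i \<notin> {a, b, c} \<Longrightarrow> cyc a b c i = i"
      using d by (auto simp: cyc_def Transposition.transpose_def)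
    have ne: "a \<noteq> b" "a \<noteq> c" "b \<noteq> c" "b \<noteq> a" "c \<noteq> a" "c \<noteq> b"
      using d by auto
    note defs = complex_matrix_def cycle_matrix_def rank_one_defect_def direction_def
    have entries:
      "?X $ a $ a = - 1 - (6 + \<i>) / 14" "?X $ a $ b = 2 - (5 - 5 * \<i>) / 14"
      "?X $ a $ c = - 2 - (1 - \<i>) / 14"
      "?X $ b $ a = 2" "?X $ b $ b = - 2" "?X $ b $ c = 5"
      "?X $ c $ a = 2 - (6 + \<i>) / 14" "?X $ c $ b = - 1 - (5 - 5 * \<i>) / 14"
      "?X $ c $ c = 2 - (1 - \<i>) / 14"
      by (simp_all add: defs cyc ne)
    have zero: "?X $ i $ j = 0" if "i \<in> {a, b, c}" "j \<notin> {a, b, c}" for i j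
      using d that by (auto simp: defs cyc)
    have diag: "?X $ i $ j = (if i = j then - 1 else 0)" if "i \<notin> {a, b, c}" for i j
      using that by (auto simp: defs cyc)
    have comp: "(\<Sum>j\<in>UNIV. ?X $ i $ j * v $ j) = z * v $ i" for i
      using ev by (simp add: vec_eq_iff matrix_vector_mult_def)
    have block: "?X $ i $ a * v $ a + ?X $ i $ b * v $ b + ?X $ i $ c * v $ c = z * v $ i"
      if "i \<in> {a, b, c}" for i
    proof -
      have "(\<Sum>j\<in>{a, b, c}. ?X $ i $ j * v $ j) = z * v $ i"
        unfolding comp[symmetric]
        by (intro sum.mono_neutral_left) (simp_all add: zero[OF that] del: vector_minus_component)
      then show ?thesis
        using d by (simp add: add.assoc del: vector_minus_component)
    qed
    have outside: "- v $ i = z * v $ i" if "i \<notin> {a, b, c}" for i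
      using comp[of i] by (simp add: diag[OF that] if_distrib if_distribR cong: if_cong
          del: vector_minus_component)
    show ?thesis
    proof (cases "v $ a \<noteq> 0 \<or> v $ b \<noteq> 0 \<or> v $ c \<noteq> 0")
      case True
      show ?thesis
      proof (rule block_eigenvalue[OF _ _ _ True])
        show "- v $ a + 2 * v $ b - 2 * v $ c -
            ((6 + \<i>) * v $ a + (5 - 5 * \<i>) * v $ b + (1 - \<i>) * v $ c) / 14 = z * v $ a"
          using block[of a] unfolding entries
          by (simp add: algebra_simps add_divide_distrib diff_divide_distrib)
        show "2 * v $ a - 2 * v $ b + 5 * v $ c = z * v $ b"
          using block[of b] unfolding entries
          by (simp add: algebra_simps add_divide_distrib diff_divide_distrib)
        show "2 * v $ a - v $ b + 2 * v $ c -
            ((6 + \<i>) * v $ a + (5 - 5 * \<i>) * v $ b + (1 - \<i>) * v $ c) / 14 = z * v $ c"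
          using block[of c] unfolding entries
          by (simp add: algebra_simps add_divide_distrib diff_divide_distrib)
      qed
    next
      case False
      then obtain i where i: "v $ i \<noteq> 0" "i \<notin> {a, b, c}"
        using \<open>v \<noteq> 0\<close> by (auto simp: vec_eq_iff)
      have "z * v $ i = - 1 * v $ i"
        using outside[OF i(2)] by simp
      then have "z = - 1"
        unfolding mult_right_cancel[OF i(1)] .
      then show ?thesis by simp
    qed
  qed
  then show ?thesis
    by (auto simp: left_half_plane_matrices_def eigenvalue_def)
qed

section \<open>Strict inequality and equality of the distances\<close>

text \<open>Eigenvalues scale by r. This allows the example to be normalized to the unit
  sphere.\<close>

lemma left_half_plane_scaleR:
  assumes "X \<in> left_half_plane_matrices" and "r > 0"
  shows "r *\<^sub>R X \<in> left_half_plane_matrices"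
proof -
  have "Re z \<le> 0" if "v \<noteq> 0" "(r *\<^sub>R X) *v v = z *s v" for v z
  proof -
    have "r *\<^sub>R (X *v v) = z *s v"
      using that(2) by (simp add: scaleR_matrix_vector_mult)
    then have "X *v v = (z / of_real r) *s v"
      using \<open>r > 0\<close> by (auto simp: vec_eq_iff scaleR_conv_of_real[where 'a = complex] field_simps)
    then have "eigenvalue X (z / of_real r)"
      using that(1) by (auto simp: eigenvalue_def)
    then have "Re (z / of_real r) \<le> 0"
      using assms(1) unfolding left_half_plane_matrices_def by blast
    then show ?thesis
      using \<open>r > 0\<close> by (simp add: divide_le_0_iff)
  qed
  then show ?thesis
    by (auto simp: left_half_plane_matrices_def eigenvalue_def)
qed

lemma dist_complex_less_dist_real:
  fixes a b c :: "'n::finite"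
  assumes d: "distinct [a, b, c]" and "r > 0"
  shows "dist_complex (r *\<^sub>R cycle_matrix a b c 1) < dist_real (r *\<^sub>R cycle_matrix a b c 1)"
proof -
  let ?M = "cycle_matrix a b c 1" and ?F = "rank_one_defect a b c"
  have scale: "complex_matrix (q *\<^sub>R A) = q *\<^sub>R complex_matrix A" for q and A :: "real ^ 'n ^ 'n"
    by (rule linear_scale[OF linear_complex_matrix])
  have "dist_complex (r *\<^sub>R ?M) \<le> dist (complex_matrix (r *\<^sub>R ?M)) (r *\<^sub>R (complex_matrix ?M - ?F))"
    unfolding dist_complex_eq_infdist using d \<open>r > 0\<close>
    by (intro infdist_le left_half_plane_scaleR cycle_matrix_minus_defect_stable)
  also have "\<dots> = r * norm ?F"
    using \<open>r > 0\<close> by (simp add: scale dist_norm algebra_simps)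
  also have "\<dots> < r"
    using norm_rank_one_defect[OF d] \<open>r > 0\<close> by simp
  also have "r \<le> dist_real (r *\<^sub>R ?M)"
    unfolding dist_real_def
  proof (rule cINF_greatest)
    show "left_half_plane_matrices \<inter> range complex_matrix \<noteq> ({} :: (complex ^ 'n ^ 'n) set)"
      using zero_stable_real by blast
  next
    fix X :: "complex ^ 'n ^ 'n" assume "X \<in> left_half_plane_matrices \<inter> range complex_matrix"
    then obtain Y where Y: "X = complex_matrix Y" "complex_matrix Y \<in> left_half_plane_matrices"
      by blast
    \<comment> \<open>Dividing by r reduces the bound to the unscaled matrix.\<close>
    have "complex_matrix ((1 / r) *\<^sub>R Y) \<in> left_half_plane_matrices"
      using left_half_plane_scaleR[OF Y(2), of "1 / r"] \<open>r > 0\<close> by (simp add: scale)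
    from dist_real_stable_cycle_matrix_ge_1[OF d this]
    have "r * 1 \<le> r * norm (?M - (1 / r) *\<^sub>R Y)"
      using \<open>r > 0\<close> by (intro mult_left_mono) auto
    also have "\<dots> = norm (r *\<^sub>R (?M - (1 / r) *\<^sub>R Y))"
      using \<open>r > 0\<close> by simp
    also have "\<dots> = norm (r *\<^sub>R ?M - Y)"
      using \<open>r > 0\<close> by (simp add: scaleR_diff_right del: norm_scaleR)
    also have "\<dots> = norm (complex_matrix (r *\<^sub>R ?M) - X)"
      unfolding Y(1) linear_diff[OF linear_complex_matrix, symmetric] by simp
    finally show "r \<le> norm (complex_matrix (r *\<^sub>R ?M) - X)" by simp
  qed
  finally show ?thesis .
qed

text \<open>An eigenvalue z of \<open>A\<close> gives the eigenvalue z + s of A + s I, so |z + s| <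
  s and Re z < 0. Thus \<open>A\<close> itself is stable and both distances vanish.\<close>

lemma dist_eq_near_negative_identity:
  fixes A :: "real ^ 'n ^ 'n"
  assumes "norm (A + s *\<^sub>R mat 1) < s"
  shows "dist_real A = dist_complex A"
proof -
  have "Re z \<le> 0" if v: "v \<noteq> 0" "complex_matrix A *v v = z *s v" for v z
  proof -
    have "complex_matrix (A + s *\<^sub>R mat 1) *v v = (z + of_real s) *s v"
    proof -
      have eq: "complex_matrix (A + s *\<^sub>R mat 1) = complex_matrix A + s *\<^sub>R mat 1"
        by (auto simp: vec_eq_iff complex_matrix_def mat_def scaleR_conv_of_real[where 'a = complex])
      show ?thesis
        unfolding eq matrix_vector_mult_add_rdistrib scaleR_matrix_vector_mult v(2)
        by (simp add: vec_eq_iff scaleR_conv_of_real[where 'a = complex] algebra_simps)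
    qed
    then have "norm ((z + of_real s) *s v) \<le> norm (A + s *\<^sub>R mat 1) * norm v"
      using norm_matrix_vector_mult_le[of "complex_matrix (A + s *\<^sub>R mat 1)" v] by simp
    also have "norm ((z + of_real s) *s v) = norm (z + of_real s) * norm v"
      by (rule norm_vector_smult)
    finally have "norm (z + of_real s) < s"
      using v(1) assms by simp
    then show ?thesis
      using abs_Re_le_cmod[of "z + of_real s"] by simp
  qed
  then have "complex_matrix A \<in> left_half_plane_matrices"
    by (auto simp: left_half_plane_matrices_def eigenvalue_def)
  then show ?thesis
    by (simp add: dist_real_eq_infdist dist_complex_eq_infdist)
qed

section \<open>Bounds for the probability\<close>

theorem mainTheorem6:
  assumes "CARD('n::finite) \<ge> 3"
  shows "0 < \<P>(A in (uniform_unit_sphere :: (real ^ 'n ^ 'n) measure). dist_real A = dist_complex A)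
       \<and> \<P>(A in (uniform_unit_sphere :: (real ^ 'n ^ 'n) measure). dist_real A = dist_complex A) < 1"
proof -
  let ?\<mu> = "uniform_unit_sphere :: (real ^ 'n ^ 'n) measure"
  interpret prob_space ?\<mu> by (rule prob_space_uniform_unit_sphere)
  let ?S = "{A :: real ^ 'n ^ 'n. dist_real A = dist_complex A}"
  let ?W = "{A :: real ^ 'n ^ 'n. dist_complex A < dist_real A}"
  have event: "{A \<in> space ?\<mu>. dist_real A = dist_complex A} = ?S \<inter> sphere 0 1"
    by (auto simp: space_uniform_unit_sphere)
  have sets: "T \<inter> sphere 0 1 \<in> events" if "T \<in> sets borel" for T
    using that unfolding uniform_unit_sphere_def
    by (auto simp: sets_restrict_space)
  have "closed ?S"
    by (intro closed_Collect_eq continuous_dist_complex continuous_dist_real)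
  then have mS: "?S \<inter> sphere 0 1 \<in> events"
    by (intro sets borel_closed)
  have oW: "open ?W"
    by (intro open_Collect_less continuous_dist_complex continuous_dist_real)
  have "prob (?S \<inter> sphere 0 1) > 0"
  proof -
    \<comment> \<open>This choice of s puts -s I on the unit sphere.\<close>
    define s where "s = 1 / norm (mat 1 :: real ^ 'n ^ 'n)"
    let ?B = "ball (- s *\<^sub>R mat 1) s :: (real ^ 'n ^ 'n) set"
    have ne: "mat 1 \<noteq> (0 :: real ^ 'n ^ 'n)"
      by (auto simp: vec_eq_iff mat_def)
    then have "s > 0" by (simp add: s_def)
    have "?B \<subseteq> ?S"
      using dist_eq_near_negative_identity[of _ s]
      by (auto simp: dist_norm norm_minus_commute add.commute)
    then have "prob (?B \<inter> sphere 0 1) \<le> prob (?S \<inter> sphere 0 1)"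
      using mS by (intro finite_measure_mono) auto
    moreover have "prob (?B \<inter> sphere 0 1) > 0"
      using \<open>s > 0\<close> ne
      by (intro measure_uniform_unit_sphere_pos[of _ "- s *\<^sub>R mat 1"]) (auto simp: s_def)
    ultimately show ?thesis by linarith
  qed
  moreover have "prob (?S \<inter> sphere 0 1) < 1"
  proof -
    obtain a b c :: 'n where d: "distinct [a, b, c]"
    proof -
      obtain C :: "'n set" where "card C = 3"
        using obtain_subset_with_card_n[OF assms] by blast
      then show ?thesis
        using that by (auto simp: card_3_iff)
    qed
    let ?M = "cycle_matrix a b c 1"
    have "complex_matrix (0 :: real ^ 'n ^ 'n) \<in> left_half_plane_matrices"
      using zero_stable_real[THEN IntD1] by (simp only: linear_0[OF linear_complex_matrix])
    \<comment> \<open>The zero matrix is real and stable, so the example has norm at least 1 and can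
      be normalized.\<close>
    then have "?M \<noteq> 0"
      using dist_real_stable_cycle_matrix_ge_1[OF d] by fastforce
    then have "sgn ?M \<in> ?W" "norm (sgn ?M) = 1"
      using dist_complex_less_dist_real[OF d] by (auto simp: sgn_div_norm norm_sgn)
    then have "prob (?W \<inter> sphere 0 1) > 0"
      by (rule measure_uniform_unit_sphere_pos[OF oW])
    \<comment> \<open>The events of equality and of strict inequality are disjoint, so the positive
      probability of the latter keeps that of the former below 1.\<close>
    moreover have "prob ((?S \<inter> sphere 0 1) \<union> (?W \<inter> sphere 0 1))
        = prob (?S \<inter> sphere 0 1) + prob (?W \<inter> sphere 0 1)"
      using oW by (intro finite_measure_Union mS sets borel_open) auto
    moreover have "prob ((?S \<inter> sphere 0 1) \<union> (?W \<inter> sphere 0 1)) \<le> 1"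
      by simp
    ultimately show ?thesis by linarith
  qed
  ultimately show ?thesis
    unfolding event by simp
qed

end
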